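(* Let $k\ge 3$ and let $G$ be a $k$-regular graph. For every strong edge coloring $\sigma$ of $G$ with colors $\{1,\dots,2k-1\}$, the map $f_\sigma$ sending each vertex $v$ of $G$ to the $(k-1)$-element set of colors not occurring on the edges incident with $v$ is a covering projection $f_\sigma\colon G\to K(2k-1,k-1)$ (and this is the covering projection determined by $\sigma$). Moreover, two such colorings $\sigma$ and $\tau$ are equivalent if and only if the covering projections $f_\sigma$ and $f_\tau$ are equivalent.
   Context: A strong edge coloring is a proper edge coloring with no bichromatic path of length three. The Kneser graph $K(2k-1,k-1)$ has as vertices the $(k-1)$-subsets of $\{1,\dots,2k-1\}$, adjacent iff disjoint. A surjective homomorphism $f\colon\tilde G\to H$ is a covering projection if for every vertex $\tilde v$ the edges incident with $\tilde v$ are mapped bijectively onto the edges incident with $f(\tilde v)$. Two edge colorings $\phi_1,\phi_2$ of $G$ are equivalent if there is an automorphism $\alpha$ of $G$ with $\phi_2(e)=\phi_1(\alpha(e))$ for every edge $e$. Two covering projections $f_1,f_2\colon G\to H$ are equivalent if there is an automorphism $\beta$ of $G$ with $f_2=f_1\circ\beta$. *)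

theory Defs
  imports Main
begin

text \<open>
  Graphs are undirected, without loops or parallel edges: an edge is the two-element set of its
  end vertices. Infinite graphs are allowed; regularity of positive degree makes them locally finite.
\<close>

record 'a ugraph =
  verts :: "'a set"
  edges :: "'a set set"

definition simple_graph :: "'a ugraph \<Rightarrow> bool" where
  "simple_graph G \<longleftrightarrow> (\<forall>e\<in>edges G. e \<subseteq> verts G \<and> card e = 2)"

definition incident_edges :: "'a ugraph \<Rightarrow> 'a \<Rightarrow> 'a set set" where
  "incident_edges G v = {e \<in> edges G. v \<in> e}"

definition regular_graph :: "nat \<Rightarrow> 'a ugraph \<Rightarrow> bool" where
  "regular_graph k G \<longleftrightarrow> (\<forall>v\<in>verts G. card (incident_edges G v) = k)"

definition graph_hom :: "'a ugraph \<Rightarrow> 'b ugraph \<Rightarrow> ('a \<Rightarrow> 'b) \<Rightarrow> bool" where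
  "graph_hom G H f \<longleftrightarrow> (\<forall>v\<in>verts G. f v \<in> verts H) \<and> (\<forall>e\<in>edges G. f ` e \<in> edges H)"

definition graph_automorphism :: "'a ugraph \<Rightarrow> ('a \<Rightarrow> 'a) \<Rightarrow> bool" where
  "graph_automorphism G \<alpha> \<longleftrightarrow>
     bij_betw \<alpha> (verts G) (verts G) \<and>
     (\<forall>u\<in>verts G. \<forall>v\<in>verts G. {u, v} \<in> edges G \<longleftrightarrow> {\<alpha> u, \<alpha> v} \<in> edges G)"

text \<open>Surjectivity is required on vertices and on edges.\<close>

definition covering_projection :: "'a ugraph \<Rightarrow> 'b ugraph \<Rightarrow> ('a \<Rightarrow> 'b) \<Rightarrow> bool" where
  "covering_projection G H f \<longleftrightarrow>
     graph_hom G H f \<and> f ` verts G = verts H \<and> (\<lambda>e. f ` e) ` edges G = edges H \<and>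
     (\<forall>v\<in>verts G. bij_betw (\<lambda>e. f ` e) (incident_edges G v) (incident_edges H (f v)))"

text \<open>For \<open>r = 0\<close> the empty set is disjoint from itself; for \<open>r \<ge> 1\<close> disjoint vertices are distinct
  and the graph is simple.\<close>

definition kneser :: "nat \<Rightarrow> nat \<Rightarrow> nat set ugraph" where
  "kneser n r =
     \<lparr>verts = {A. A \<subseteq> {1..n} \<and> card A = r},
      edges = {{A, B} | A B. A \<subseteq> {1..n} \<and> card A = r \<and> B \<subseteq> {1..n} \<and> card B = r \<and> A \<inter> B = {}}\<rparr>"

text \<open>Colorings are total functions of which only the values on \<open>edges G\<close> matter.
  Not every color of \<open>C\<close> has to be used.\<close>

definition proper_edge_coloring :: "'a ugraph \<Rightarrow> 'c set \<Rightarrow> ('a set \<Rightarrow> 'c) \<Rightarrow> bool" where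
  "proper_edge_coloring G C \<phi> \<longleftrightarrow>
     (\<forall>e\<in>edges G. \<phi> e \<in> C) \<and>
     (\<forall>e\<in>edges G. \<forall>e'\<in>edges G. e \<noteq> e' \<and> e \<inter> e' \<noteq> {} \<longrightarrow> \<phi> e \<noteq> \<phi> e')"

definition bichromatic_path3 ::
    "'a ugraph \<Rightarrow> ('a set \<Rightarrow> 'c) \<Rightarrow> 'a \<Rightarrow> 'a \<Rightarrow> 'a \<Rightarrow> 'a \<Rightarrow> bool" where
  "bichromatic_path3 G \<phi> a b c d \<longleftrightarrow>
     distinct [a, b, c, d] \<and> {a, b} \<in> edges G \<and> {b, c} \<in> edges G \<and> {c, d} \<in> edges G \<and>
     card {\<phi> {a, b}, \<phi> {b, c}, \<phi> {c, d}} = 2"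

definition strong_edge_coloring :: "'a ugraph \<Rightarrow> 'c set \<Rightarrow> ('a set \<Rightarrow> 'c) \<Rightarrow> bool" where
  "strong_edge_coloring G C \<phi> \<longleftrightarrow>
     proper_edge_coloring G C \<phi> \<and> (\<nexists>a b c d. bichromatic_path3 G \<phi> a b c d)"

definition missing_colors :: "'a ugraph \<Rightarrow> 'c set \<Rightarrow> ('a set \<Rightarrow> 'c) \<Rightarrow> 'a \<Rightarrow> 'c set" where
  "missing_colors G C \<phi> v = C - \<phi> ` incident_edges G v"

definition equivalent_colorings ::
    "'a ugraph \<Rightarrow> ('a set \<Rightarrow> 'c) \<Rightarrow> ('a set \<Rightarrow> 'c) \<Rightarrow> bool" where
  "equivalent_colorings G \<phi>1 \<phi>2 \<longleftrightarrow>
     (\<exists>\<alpha>. graph_automorphism G \<alpha> \<and> (\<forall>e\<in>edges G. \<phi>2 e = \<phi>1 (\<alpha> ` e)))"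

text \<open>In a simple graph a homomorphism is determined by its action on vertices, so equality of
  maps is equality on \<open>verts G\<close>.\<close>

definition equivalent_projections :: "'a ugraph \<Rightarrow> ('a \<Rightarrow> 'b) \<Rightarrow> ('a \<Rightarrow> 'b) \<Rightarrow> bool" where
  "equivalent_projections G f1 f2 \<longleftrightarrow>
     (\<exists>\<beta>. graph_automorphism G \<beta> \<and> (\<forall>v\<in>verts G. f2 v = f1 (\<beta> v)))"

end

theory Submission
  imports Defs
begin

text \<open>
  In a strong edge coloring the color sets at the two ends of an edge \<open>uv\<close> share only the color of
  \<open>uv\<close>, so with \<open>2k - 1\<close> colors they exhaust all of them. Hence the colors missing at \<open>v\<close> are those
  seen at \<open>u\<close> except the color of \<open>uv\<close>, which gives local bijectivity, and the color of \<open>uv\<close> is the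
  only one missing neither at \<open>u\<close> nor at \<open>v\<close>, so the projection determines the coloring.
  Surjectivity follows from the connectedness of the Kneser graph: exchanging one element of a
  \<open>(k - 1)\<close>-set is a walk of length two.
\<close>

section \<open>Edges of simple graphs and automorphisms\<close>

lemma simple_graph_edgeE:
  assumes "simple_graph G" and "e \<in> edges G" and "u \<in> e"
  obtains v where "e = {u, v}" and "u \<noteq> v" and "u \<in> verts G" and "v \<in> verts G"
proof -
  have "card e = 2" and sub: "e \<subseteq> verts G"
    using assms(1,2) by (auto simp: simple_graph_def)
  then obtain x y where "e = {x, y}" "x \<noteq> y"
    by (auto simp: card_2_iff)
  with assms(3) sub that show thesis
    by (metis insert_commute insert_iff insert_subset singletonD)
qed

lemma simple_graph_edgeD:
  assumes "simple_graph G" and "{u, v} \<in> edges G"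
  shows "u \<noteq> v" and "u \<in> verts G" and "v \<in> verts G"
proof -
  have "card {u, v} = 2" "{u, v} \<subseteq> verts G"
    using assms by (auto simp: simple_graph_def)
  then show "u \<noteq> v" "u \<in> verts G" "v \<in> verts G"
    by auto
qed

text \<open>For the reverse inclusion, the far end of an edge at \<open>\<alpha> v\<close> has a
  preimage by surjectivity on vertices, and the equivalence in \<open>graph_automorphism\<close>
  pulls the edge back.\<close>

lemma graph_automorphism_incident_edges:
  assumes G: "simple_graph G" and \<alpha>: "graph_automorphism G \<alpha>" and v: "v \<in> verts G"
  shows "(\<lambda>e. \<alpha> ` e) ` incident_edges G v = incident_edges G (\<alpha> v)"
proof (intro equalityI subsetI)
  fix e assume "e \<in> (\<lambda>e. \<alpha> ` e) ` incident_edges G v"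
  then obtain e' where e': "e' \<in> edges G" "v \<in> e'" "e = \<alpha> ` e'"
    by (auto simp: incident_edges_def)
  then obtain w where "e' = {v, w}" "w \<in> verts G"
    using simple_graph_edgeE[OF G] by metis
  with e' v \<alpha> show "e \<in> incident_edges G (\<alpha> v)"
    by (auto simp: graph_automorphism_def incident_edges_def)
next
  fix e assume "e \<in> incident_edges G (\<alpha> v)"
  then have e: "e \<in> edges G" "\<alpha> v \<in> e"
    by (auto simp: incident_edges_def)
  then obtain w where w: "e = {\<alpha> v, w}" "w \<in> verts G"
    using simple_graph_edgeE[OF G] by metis
  then obtain w' where w': "w' \<in> verts G" "w = \<alpha> w'"
    using \<alpha> unfolding graph_automorphism_def bij_betw_def by blast
  have "{v, w'} \<in> edges G"
    using e w w' v \<alpha> by (auto simp: graph_automorphism_def)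
  then have "{v, w'} \<in> incident_edges G v"
    by (simp add: incident_edges_def)
  moreover have "e = \<alpha> ` {v, w'}"
    using w w' by simp
  ultimately show "e \<in> (\<lambda>e. \<alpha> ` e) ` incident_edges G v"
    by blast
qed

section \<open>Colors at the two ends of an edge\<close>

text \<open>Two edges of equal color other than \<open>{u, v}\<close> would extend it at both ends
  to a bichromatic path of length three. If one of them is \<open>{u, v}\<close>, properness at the
  end where it meets the other identifies them.\<close>

lemma strong_edge_coloring_eq_imp_same_edge:
  assumes G: "simple_graph G" and \<sigma>: "strong_edge_coloring G C \<sigma>"
    and uv: "{u, v} \<in> edges G"
    and e: "e \<in> incident_edges G u" and e': "e' \<in> incident_edges G v"
    and eq: "\<sigma> e = \<sigma> e'"
  shows "e = {u, v} \<and> e' = {u, v}"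
proof -
  have edge: "e \<in> edges G" "u \<in> e" "e' \<in> edges G" "v \<in> e'"
    using e e' by (auto simp: incident_edges_def)
  have proper: "x = y" if "x \<in> edges G" "y \<in> edges G" "z \<in> x" "z \<in> y" "\<sigma> x = \<sigma> y" for x y z
    using \<sigma> that unfolding strong_edge_coloring_def proper_edge_coloring_def by blast
  consider "e = {u, v}" | "e' = {u, v}" | "e \<noteq> {u, v}" "e' \<noteq> {u, v}" by blast
  then show ?thesis
  proof cases
    case 1
    then show ?thesis using proper[of e e' v] edge eq by auto
  next
    case 2
    then show ?thesis using proper[of e e' u] edge eq by auto
  next
    case 3
    obtain a where a: "e = {u, a}" "u \<noteq> a"
      using simple_graph_edgeE[OF G edge(1,2)] by metis
    obtain b where b: "e' = {v, b}" "v \<noteq> b"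
      using simple_graph_edgeE[OF G edge(3,4)] by metis
    have ne: "a \<noteq> v" "b \<noteq> u" "u \<noteq> v"
      using 3 a b simple_graph_edgeD[OF G uv] by auto
    \<comment> \<open>A triangle is not a path, so this case is settled by properness at the common
      vertex \<open>a\<close>.\<close>
    have "a \<noteq> b"
    proof
      assume "a = b"
      then have "e = e'"
        using proper[of e e' a] edge eq a b by auto
      then show False using a b \<open>a = b\<close> ne by auto
    qed
    \<comment> \<open>\<open>bichromatic_path3\<close> demands exactly two colors, so a
      monochromatic path has to be ruled out as well.\<close>
    moreover have "\<sigma> e \<noteq> \<sigma> {u, v}"
      using proper[of e "{u, v}" u] edge uv 3 by auto
    ultimately have "bichromatic_path3 G \<sigma> a u v b"
      using a b ne edge uv eq by (auto simp: bichromatic_path3_def insert_commute)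
    then show ?thesis
      using \<sigma> by (auto simp: strong_edge_coloring_def)
  qed
qed

lemma card_colors_at_vertex:
  assumes "regular_graph k G" and "strong_edge_coloring G C \<sigma>" and "v \<in> verts G"
  shows "card (\<sigma> ` incident_edges G v) = k"
proof -
  have "inj_on \<sigma> (incident_edges G v)"
    using assms(2) unfolding strong_edge_coloring_def proper_edge_coloring_def inj_on_def
      incident_edges_def by blast
  then show ?thesis
    using assms(1,3) by (simp add: card_image regular_graph_def)
qed

lemma colors_at_vertex_subset:
  assumes "strong_edge_coloring G C \<sigma>"
  shows "\<sigma> ` incident_edges G v \<subseteq> C"
  using assms by (auto simp: strong_edge_coloring_def proper_edge_coloring_def incident_edges_def)

lemma card_missing_colors:
  assumes "regular_graph k G" and "strong_edge_coloring G C \<sigma>" and "finite C" and "v \<in> verts G"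
  shows "card (missing_colors G C \<sigma> v) = card C - k"
  unfolding missing_colors_def
  using card_colors_at_vertex[OF assms(1,2,4)] colors_at_vertex_subset[OF assms(2)] assms(3)
  by (metis card_Diff_subset finite_subset)

text \<open>By inclusion-exclusion the union of the two color sets has \<open>k + k - 1\<close>
  elements, which is \<open>card C\<close>.\<close>

lemma missing_colors_adjacent:
  assumes G: "simple_graph G" and k: "k > 0" "regular_graph k G"
    and C: "card C = 2 * k - 1" and \<sigma>: "strong_edge_coloring G C \<sigma>"
    and uv: "{u, v} \<in> edges G"
  shows "missing_colors G C \<sigma> v = \<sigma> ` incident_edges G u - {\<sigma> {u, v}}"
proof -
  let ?U = "\<sigma> ` incident_edges G u" and ?V = "\<sigma> ` incident_edges G v"
  \<comment> \<open>An infinite set has \<open>card\<close> equal to 0, whereas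
    \<open>2 * k - 1\<close> is positive.\<close>
  have fin: "finite C" using C k(1) by (intro card_ge_0_finite) simp
  have sub: "?U \<subseteq> C" "?V \<subseteq> C"
    using colors_at_vertex_subset[OF \<sigma>] by auto
  have card: "card ?U = k" "card ?V = k"
    using card_colors_at_vertex[OF k(2) \<sigma>] simple_graph_edgeD[OF G uv] by auto
  have int: "?U \<inter> ?V = {\<sigma> {u, v}}"
    using strong_edge_coloring_eq_imp_same_edge[OF G \<sigma> uv] uv by (fastforce simp: incident_edges_def)
  have "card ?U + card ?V = card (?U \<union> ?V) + card (?U \<inter> ?V)"
    using fin sub by (intro card_Un_Int) (auto intro: finite_subset)
  then have "card (?U \<union> ?V) = card C"
    using card int C by simp
  then have "?U \<union> ?V = C"
    using fin sub by (intro card_subset_eq) auto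
  with int show ?thesis
    unfolding missing_colors_def by auto
qed

lemma missing_colors_disjoint:
  assumes G: "simple_graph G" and k: "k > 0" "regular_graph k G"
    and C: "card C = 2 * k - 1" and \<sigma>: "strong_edge_coloring G C \<sigma>"
    and uv: "{u, v} \<in> edges G"
  shows "missing_colors G C \<sigma> u \<inter> missing_colors G C \<sigma> v = {}"
  unfolding missing_colors_adjacent[OF assms] by (auto simp: missing_colors_def)

text \<open>This recovers the coloring from its missing sets, as needed to pass from equivalent
  projections back to equivalent colorings.\<close>

lemma color_not_missing_at_ends:
  assumes G: "simple_graph G" and k: "k > 0" "regular_graph k G"
    and C: "card C = 2 * k - 1" and \<sigma>: "strong_edge_coloring G C \<sigma>"
    and uv: "{u, v} \<in> edges G"
  shows "C - (missing_colors G C \<sigma> u \<union> missing_colors G C \<sigma> v) = {\<sigma> {u, v}}"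
proof -
  have "\<sigma> {u, v} \<in> \<sigma> ` incident_edges G u"
    using uv by (auto simp: incident_edges_def)
  then show ?thesis
    unfolding missing_colors_adjacent[OF assms]
    using colors_at_vertex_subset[OF \<sigma>, of u] by (auto simp: missing_colors_def)
qed

section \<open>Connectedness of the Kneser graph\<close>

lemma kneser_edge_iff:
  "{A, B} \<in> edges (kneser n r) \<longleftrightarrow>
     A \<in> verts (kneser n r) \<and> B \<in> verts (kneser n r) \<and> A \<inter> B = {}"
  by (auto simp: kneser_def doubleton_eq_iff)

lemma kneser_edgeE:
  assumes "e \<in> edges (kneser n r)" and "A \<in> e"
  obtains B where "e = {A, B}"
  using assms by (auto simp: kneser_def insert_commute)

lemma kneser_closed_set_eq_verts:
  \<comment> \<open>Connectedness is phrased through sets closed under adjacency, so no walks have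
    to be formalized. It is applied to the image of the projection.\<close>
  assumes n: "n > 2 * r" and S: "S \<subseteq> verts (kneser n r)" "A \<in> S"
    and closed: "\<And>X Y. X \<in> S \<Longrightarrow> {X, Y} \<in> edges (kneser n r) \<Longrightarrow> Y \<in> S"
  shows "S = verts (kneser n r)"
proof -
  have vertD: "X \<subseteq> {1..n}" "card X = r" "finite X" if "X \<in> verts (kneser n r)" for X
    using that finite_subset[of X "{1..n}"] unfolding kneser_def by auto
  have exchange: "insert b (X - {a}) \<in> S" if X: "X \<in> S" and ab: "a \<in> X" "b \<in> {1..n} - X" for X a b
  proof -
    have XV: "X \<subseteq> {1..n}" "card X = r" "finite X"
      using vertD X S(1) by blast+
    \<comment> \<open>There are \<open>n - r - 1\<close> elements left, so \<open>n > 2 * r\<close>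
      leaves room for a set \<open>Z\<close> disjoint from both \<open>X\<close> and the exchanged
      set: a common neighbor of the two.\<close>
    then have "card ({1..n} - X - {b}) \<ge> r"
      using n ab by (simp add: card_Diff_subset)
    then obtain Z where Z: "Z \<subseteq> {1..n} - X - {b}" "card Z = r"
      by (meson obtain_subset_with_card_n)
    then have "{X, Z} \<in> edges (kneser n r)"
      unfolding kneser_edge_iff using XV by (auto simp: kneser_def)
    then have ZS: "Z \<in> S"
      using closed X by blast
    have "card (insert b (X - {a})) = r"
      using XV ab by (metis DiffD1 DiffD2 card_Suc_Diff1 card_insert_disjoint finite_Diff)
    then have "{Z, insert b (X - {a})} \<in> edges (kneser n r)"
      unfolding kneser_edge_iff using XV Z ab by (auto simp: kneser_def)
    then show ?thesis
      using closed ZS by blast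
  qed
  have "B \<in> S" if "B \<in> verts (kneser n r)" for B
    using \<open>A \<in> S\<close>
  \<comment> \<open>Each exchange replaces an element of \<open>A - B\<close> by one of
    \<open>B - A\<close> and lowers this number by one.\<close>
  proof (induction "card (A - B)" arbitrary: A)
    case 0
    have "card A = r" "card B = r" "finite A" "finite B"
      using 0 S(1) that vertD by blast+
    then have "A = B"
      using 0 by (simp add: card_subset_eq)
    then show ?case using 0 by simp
  next
    case (Suc m)
    have AB: "card A = r" "card B = r" "finite A" "finite B" "B \<subseteq> {1..n}"
      using Suc(3) S(1) that vertD by blast+
    obtain a where a: "a \<in> A" "a \<notin> B"
      using Suc(2) by (metis DiffE all_not_in_conv card.empty nat.distinct(1))
    then have "\<not> B \<subseteq> A"
      using AB card_subset_eq[of A B] by auto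
    then obtain b where b: "b \<in> B" "b \<notin> A" by auto
    have "insert b (A - {a}) - B = A - B - {a}"
      using b by auto
    then have "card (insert b (A - {a}) - B) = m"
      using a AB Suc(2) by simp
    moreover have "insert b (A - {a}) \<in> S"
      using exchange Suc(3) a b AB by auto
    ultimately show ?case using Suc(1) by metis
  qed
  then show ?thesis using S(1) by auto
qed

section \<open>The covering projection of a strong edge coloring\<close>

lemma covering_projection_missing_colors:
  assumes k: "k > 0" and G: "simple_graph G" "verts G \<noteq> {}" "regular_graph k G"
    and \<sigma>: "strong_edge_coloring G {1..2 * k - 1} \<sigma>"
  shows "covering_projection G (kneser (2 * k - 1) (k - 1)) (missing_colors G {1..2 * k - 1} \<sigma>)"
proof -
  let ?f = "missing_colors G {1..2 * k - 1} \<sigma>"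
  let ?K = "kneser (2 * k - 1) (k - 1)"
  have C: "card {1..2 * k - 1} = 2 * k - 1" by simp
  note adjacent = missing_colors_adjacent[OF G(1) k G(3) C \<sigma>]
  \<comment> \<open>The size is right because \<open>(2 * k - 1) - k = k - 1\<close>.\<close>
  have vert: "?f v \<in> verts ?K" if "v \<in> verts G" for v
    using card_missing_colors[OF G(3) \<sigma> _ that] k
    by (auto simp: kneser_def missing_colors_def)
  have edge: "?f ` e \<in> edges ?K" if e: "e \<in> edges G" for e
  proof -
    have "card e = 2" using G(1) e by (auto simp: simple_graph_def)
    then obtain u v where uv: "e = {u, v}"
      by (auto simp: card_2_iff)
    have "{?f u, ?f v} \<in> edges ?K"
      unfolding kneser_edge_iff
      using missing_colors_disjoint[OF G(1) k G(3) C \<sigma>] simple_graph_edgeD[OF G(1)] e uv vert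
      by blast
    then show ?thesis by (simp add: uv)
  qed
  have bij: "bij_betw (\<lambda>e. ?f ` e) (incident_edges G v) (incident_edges ?K (?f v))"
    if v: "v \<in> verts G" for v
  proof (rule bij_betw_imageI)
    show "inj_on (\<lambda>e. ?f ` e) (incident_edges G v)"
    proof (rule inj_onI)
      fix e e' assume e: "e \<in> incident_edges G v" "e' \<in> incident_edges G v" "?f ` e = ?f ` e'"
      obtain w where w: "e = {v, w}"
        using e(1) simple_graph_edgeE[OF G(1)] unfolding incident_edges_def by blast
      obtain w' where w': "e' = {v, w'}"
        using e(2) simple_graph_edgeE[OF G(1)] unfolding incident_edges_def by blast
      have "?f w = ?f w'"
        using e(3) unfolding w w' by (auto simp: doubleton_eq_iff)
      \<comment> \<open>Both sides delete one color from the colors at \<open>v\<close>; equal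
        results force equal deleted colors.\<close>
      then have "\<sigma> ` incident_edges G v - {\<sigma> e} = \<sigma> ` incident_edges G v - {\<sigma> e'}"
        using adjacent e(1,2) unfolding w w' incident_edges_def by force
      then have "\<sigma> e = \<sigma> e'"
        using e(1,2) by blast
      then show "e = e'"
        using \<sigma> e(1,2) unfolding strong_edge_coloring_def proper_edge_coloring_def incident_edges_def
        by blast
    qed
    show "(\<lambda>e. ?f ` e) ` incident_edges G v = incident_edges ?K (?f v)"
    proof (intro equalityI subsetI)
      fix d assume "d \<in> (\<lambda>e. ?f ` e) ` incident_edges G v"
      then show "d \<in> incident_edges ?K (?f v)"
        using edge by (auto simp: incident_edges_def)
    next
      fix d assume "d \<in> incident_edges ?K (?f v)"
      then obtain B where d: "d = {?f v, B}" and "{?f v, B} \<in> edges ?K"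
        using kneser_edgeE unfolding incident_edges_def by (metis (no_types, lifting) mem_Collect_eq)
      then have B: "B \<subseteq> {1..2 * k - 1}" "card B = k - 1" "?f v \<inter> B = {}"
        unfolding kneser_edge_iff by (auto simp: kneser_def)
      let ?U = "\<sigma> ` incident_edges G v"
      have "B \<subseteq> ?U"
        using B by (auto simp: missing_colors_def)
      moreover have U: "card ?U = k"
        by (rule card_colors_at_vertex[OF G(3) \<sigma> v])
      moreover have "finite B" using B(1) finite_subset by blast
      \<comment> \<open>\<open>B\<close> takes up \<open>k - 1\<close> of the \<open>k\<close>
        colors at \<open>v\<close>. The edge at \<open>v\<close> with the remaining color
        \<open>c\<close> is the lift of \<open>d\<close>.\<close>
      ultimately have "card (?U - B) = 1"
        using B(2) k by (simp add: card_Diff_subset)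
      then obtain c where c: "?U - B = {c}"
        by (auto simp: card_1_singleton_iff)
      then obtain e where e: "e \<in> incident_edges G v" "c = \<sigma> e"
        by blast
      obtain w where w: "e = {v, w}"
        using e(1) simple_graph_edgeE[OF G(1)] unfolding incident_edges_def by blast
      have "?f w = ?U - {c}"
        using adjacent[of v w] e w by (auto simp: incident_edges_def)
      also have "\<dots> = B"
        using c \<open>B \<subseteq> ?U\<close> by blast
      finally have "?f ` e = d"
        by (simp add: w d)
      then show "d \<in> (\<lambda>e. ?f ` e) ` incident_edges G v"
        using e(1) by blast
    qed
  qed
  obtain v0 where "v0 \<in> verts G"
    using G(2) by blast
  have surj: "?f ` verts G = verts ?K"
  proof (rule kneser_closed_set_eq_verts)
    show "2 * k - 1 > 2 * (k - 1)" using k by simp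
    show "?f ` verts G \<subseteq> verts ?K" using vert by blast
    show "?f v0 \<in> ?f ` verts G" using \<open>v0 \<in> verts G\<close> by blast
    \<comment> \<open>Local surjectivity lifts the edge \<open>{X, Y}\<close> to an edge at a
      preimage of \<open>X\<close>, so \<open>Y\<close> is also in the image.\<close>
    fix X Y assume "X \<in> ?f ` verts G" and XY: "{X, Y} \<in> edges ?K"
    then obtain v where v: "v \<in> verts G" "X = ?f v" by blast
    have "{X, Y} \<in> incident_edges ?K (?f v)"
      using XY v by (simp add: incident_edges_def)
    then obtain e where e: "e \<in> incident_edges G v" "{X, Y} = ?f ` e"
      using bij[OF v(1)] unfolding bij_betw_def by blast
    have "e \<subseteq> verts G"
      using e(1) G(1) by (auto simp: incident_edges_def simple_graph_def)
    moreover have "Y \<in> ?f ` e"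
      unfolding e(2)[symmetric] by simp
    ultimately show "Y \<in> ?f ` verts G"
      by (meson image_mono subsetD)
  qed
  have "(\<lambda>e. ?f ` e) ` edges G = edges ?K"
  proof (intro equalityI subsetI)
    fix d assume d: "d \<in> edges ?K"
    then obtain A B where AB: "d = {A, B}" by (auto simp: kneser_def)
    with d have "A \<in> verts ?K" by (simp add: kneser_edge_iff)
    \<comment> \<open>Vertex surjectivity provides a vertex over one end of \<open>d\<close>; local
      surjectivity there lifts \<open>d\<close> itself.\<close>
    then obtain v where v: "v \<in> verts G" "A = ?f v"
      using surj by blast
    with d AB have "d \<in> incident_edges ?K (?f v)"
      by (simp add: incident_edges_def)
    then show "d \<in> (\<lambda>e. ?f ` e) ` edges G"
      using bij[OF v(1)] unfolding bij_betw_def incident_edges_def by blast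
  qed (use edge in blast)
  with vert edge bij surj show ?thesis
    by (simp add: covering_projection_def graph_hom_def)
qed

section \<open>Equivalence of colorings and of projections\<close>

text \<open>The same automorphism serves for both: it carries the edges at \<open>v\<close> onto
  those at \<open>\<alpha> v\<close>, so the colors seen by \<open>\<tau>\<close> at
  \<open>v\<close> are those seen by \<open>\<sigma>\<close> at \<open>\<alpha> v\<close>.\<close>

lemma equivalent_colorings_imp_equivalent_projections:
  assumes G: "simple_graph G" and eq: "equivalent_colorings G \<sigma> \<tau>"
  shows "equivalent_projections G (missing_colors G C \<sigma>) (missing_colors G C \<tau>)"
proof -
  obtain \<alpha> where \<alpha>: "graph_automorphism G \<alpha>" "\<And>e. e \<in> edges G \<Longrightarrow> \<tau> e = \<sigma> (\<alpha> ` e)"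
    using eq by (auto simp: equivalent_colorings_def)
  have "\<tau> ` incident_edges G v = \<sigma> ` incident_edges G (\<alpha> v)" if "v \<in> verts G" for v
    unfolding graph_automorphism_incident_edges[OF G \<alpha>(1) that, symmetric] image_image
    using \<alpha>(2) by (intro image_cong) (auto simp: incident_edges_def)
  with \<alpha>(1) show ?thesis
    by (auto simp: equivalent_projections_def missing_colors_def)
qed

text \<open>Again the automorphism is kept: the missing sets at the ends of an edge determine its
  color, so agreement on vertices along \<open>\<beta>\<close> gives agreement on edges.\<close>

lemma equivalent_projections_imp_equivalent_colorings:
  assumes G: "simple_graph G" and k: "k > 0" "regular_graph k G" and C: "card C = 2 * k - 1"
    and \<sigma>: "strong_edge_coloring G C \<sigma>" and \<tau>: "strong_edge_coloring G C \<tau>"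
    and eq: "equivalent_projections G (missing_colors G C \<sigma>) (missing_colors G C \<tau>)"
  shows "equivalent_colorings G \<sigma> \<tau>"
proof -
  obtain \<beta> where \<beta>: "graph_automorphism G \<beta>"
    "\<And>v. v \<in> verts G \<Longrightarrow> missing_colors G C \<tau> v = missing_colors G C \<sigma> (\<beta> v)"
    using eq by (auto simp: equivalent_projections_def)
  have "\<tau> e = \<sigma> (\<beta> ` e)" if e: "e \<in> edges G" for e
  proof -
    have "card e = 2" using G e by (auto simp: simple_graph_def)
    then obtain u v where uv: "e = {u, v}"
      by (auto simp: card_2_iff)
    have verts: "u \<in> verts G" "v \<in> verts G"
      using simple_graph_edgeD[OF G] e uv by auto
    have "{\<beta> u, \<beta> v} \<in> edges G"
      using \<beta>(1) e uv verts by (auto simp: graph_automorphism_def)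
    \<comment> \<open>The missing sets of \<open>\<sigma>\<close> at the image edge equal those of
      \<open>\<tau>\<close> at \<open>e\<close>, hence so do the singletons of colors that they
      leave over.\<close>
    from color_not_missing_at_ends[OF G k C \<sigma> this]
      color_not_missing_at_ends[OF G k C \<tau> e[unfolded uv]]
    have "{\<tau> {u, v}} = {\<sigma> {\<beta> u, \<beta> v}}"
      using \<beta>(2) verts by simp
    then show ?thesis by (simp add: uv)
  qed
  with \<beta>(1) show ?thesis
    by (auto simp: equivalent_colorings_def)
qed

theorem theorem7:
  fixes k :: nat and G :: "'a ugraph"
  assumes "k \<ge> 3"
    and "simple_graph G"
    and "verts G \<noteq> {}"
    and "regular_graph k G"
  shows "(\<forall>\<sigma> :: 'a set \<Rightarrow> nat. strong_edge_coloring G {1..2 * k - 1} \<sigma> \<longrightarrow>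
            covering_projection G (kneser (2 * k - 1) (k - 1)) (missing_colors G {1..2 * k - 1} \<sigma>)) \<and>
         (\<forall>\<sigma> \<tau> :: 'a set \<Rightarrow> nat.
            strong_edge_coloring G {1..2 * k - 1} \<sigma> \<longrightarrow>
            strong_edge_coloring G {1..2 * k - 1} \<tau> \<longrightarrow>
            (equivalent_colorings G \<sigma> \<tau> \<longleftrightarrow>
             equivalent_projections G (missing_colors G {1..2 * k - 1} \<sigma>)
                                      (missing_colors G {1..2 * k - 1} \<tau>)))"
proof (intro conjI allI impI)
  have k: "k > 0" using assms(1) by simp
  have C: "card {1..2 * k - 1} = 2 * k - 1" by simp
  fix \<sigma> :: "'a set \<Rightarrow> nat"
  assume \<sigma>: "strong_edge_coloring G {1..2 * k - 1} \<sigma>"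
  show "covering_projection G (kneser (2 * k - 1) (k - 1)) (missing_colors G {1..2 * k - 1} \<sigma>)"
    by (rule covering_projection_missing_colors[OF k assms(2-4) \<sigma>])
  fix \<tau> :: "'a set \<Rightarrow> nat"
  assume \<tau>: "strong_edge_coloring G {1..2 * k - 1} \<tau>"
  show "equivalent_colorings G \<sigma> \<tau> \<longleftrightarrow>
    equivalent_projections G (missing_colors G {1..2 * k - 1} \<sigma>) (missing_colors G {1..2 * k - 1} \<tau>)"
    using equivalent_colorings_imp_equivalent_projections[OF assms(2)]
      equivalent_projections_imp_equivalent_colorings[OF assms(2) k assms(4) C \<sigma> \<tau>]
    by blast
qed

end
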